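(* Let $B$ be a nonempty set of sets, partially ordered by inclusion. Assume that $B$ satisfies (K2), i.e. for all $X_1\subset X_2$ in $B$ there exist $X_1\subseteq Y_1\subset Y_2\subseteq X_2$ in $B$ such that $Y_1,Y_2$ are immediate neighbors in $B$. Assume that either (i) $B$ has a smallest member, and for every nonempty chain $C\subseteq\mathrm{IS}(B)$, $\bigcup_{X\in C}X\in B$; or (ii) $B$ has a greatest member, and for every nonempty chain $C\subseteq\mathrm{IP}(B)$, $\bigcap_{X\in C}X\in B$. If $B$ is a chain, then $B$ is order isomorphic to $D(\mathrm{IS}(B))$ and to $D(\mathrm{IP}(B))$.
   Context: $\subset$ denotes proper inclusion; a chain is a totally ordered (sub)set. In a poset $S$, $a,b$ are immediate neighbors if $a<b$ and there is no $c\in S$ with $a<c<b$; then $a$ is an immediate predecessor of $b$ and $b$ an immediate successor of $a$. $\mathrm{IS}(S)$ is the set of elements of $S$ having an immediate predecessor in $S$; $\mathrm{IP}(S)$ is the set of elements of $S$ having an immediate successor in $S$; both carry the induced order. A cut of a totally ordered set $T$ is a pair $\mathcal A=(\mathcal A^L,\mathcal A^R)$ of disjoint (possibly empty) subsets with union $T$ such that $\alpha<\beta$ for all $\alpha\in\mathcal A^L$, $\beta\in\mathcal A^R$. $D(T)$ is the set of all cuts of $T$ (including $(\emptyset,T)$ and $(T,\emptyset)$; $D(\emptyset)$ has exactly one element), totally ordered by $\mathcal A\le\mathcal B$ iff $\mathcal A^L\subseteq\mathcal B^L$. *)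

theory Defs
  imports Main
begin

definition immediate_neighbors :: "'a::order set \<Rightarrow> 'a \<Rightarrow> 'a \<Rightarrow> bool" where
  "immediate_neighbors S a b \<longleftrightarrow>
     a \<in> S \<and> b \<in> S \<and> a < b \<and> \<not> (\<exists>c\<in>S. a < c \<and> c < b)"

definition IS :: "'a::order set \<Rightarrow> 'a set" where
  "IS S = {b \<in> S. \<exists>a\<in>S. immediate_neighbors S a b}"

definition IP :: "'a::order set \<Rightarrow> 'a set" where
  "IP S = {a \<in> S. \<exists>b\<in>S. immediate_neighbors S a b}"

definition K2 :: "'a set set \<Rightarrow> bool" where
  "K2 B \<longleftrightarrow>
     (\<forall>X1\<in>B. \<forall>X2\<in>B. X1 \<subset> X2 \<longrightarrow>
        (\<exists>Y1\<in>B. \<exists>Y2\<in>B. X1 \<subseteq> Y1 \<and> Y1 \<subset> Y2 \<and> Y2 \<subseteq> X2 \<and> immediate_neighbors B Y1 Y2))"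

text \<open>The definition makes sense for any subset of an order, but is meant for a totally
  ordered carrier \<open>T\<close>.\<close>

definition cuts :: "'a::order set \<Rightarrow> ('a set \<times> 'a set) set" where
  "cuts T = {(L, R). L \<inter> R = {} \<and> L \<union> R = T \<and> (\<forall>\<alpha>\<in>L. \<forall>\<beta>\<in>R. \<alpha> < \<beta>)}"

text \<open>Cuts are compared by their lower parts only; this is not the componentwise
  order on pairs.\<close>

definition cut_le :: "'a set \<times> 'a set \<Rightarrow> 'a set \<times> 'a set \<Rightarrow> bool" where
  "cut_le \<A> \<B> \<longleftrightarrow> fst \<A> \<subseteq> fst \<B>"

definition order_isomorphic ::
  "'a set \<Rightarrow> ('a \<Rightarrow> 'a \<Rightarrow> bool) \<Rightarrow> 'b set \<Rightarrow> ('b \<Rightarrow> 'b \<Rightarrow> bool) \<Rightarrow> bool" where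
  "order_isomorphic A leA B leB \<longleftrightarrow>
     (\<exists>f. bij_betw f A B \<and> (\<forall>x\<in>A. \<forall>y\<in>A. leA x y \<longleftrightarrow> leB (f x) (f y)))"

end

theory Submission
  imports Defs
begin

text \<open>Condition (K2) makes \<open>IS B\<close> and \<open>IP B\<close> order dense enough in \<open>B\<close> that either of
  (i) and (ii) forces every subset of \<open>B\<close> to have a supremum in \<open>B\<close>: under (i), the union of
  the members of \<open>IS B\<close> lying below a member of the subset; under (ii), the intersection of the
  upper bounds lying in \<open>IP B\<close>. Each \<open>X \<in> B\<close> splits \<open>IS B\<close> into the members \<open>\<subseteq> X\<close> and the rest,
  and \<open>IP B\<close> into the members \<open>\<subset> X\<close> and the rest. By (K2) \<open>X\<close> is determined by either of these
  cuts, and every cut arises from a supremum.\<close>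

lemma chain_subset_cases:
  assumes "chain\<^sub>\<subseteq> B" "X \<in> B" "Y \<in> B"
  obtains "X \<subseteq> Y" | "Y \<subset> X"
  using assms unfolding chain_subset_def by blast

text \<open>A supremum preserves only weak bounds, while the two parts of a cut are separated
  strictly. Passing to a neighbor trades one kind of bound for the other.\<close>

lemma immediate_neighbors_chain:
  assumes chain: "chain\<^sub>\<subseteq> B" and nb: "immediate_neighbors B X Y" and Z: "Z \<in> B"
  shows "Z \<subseteq> X \<longleftrightarrow> Z \<subset> Y" "X \<subset> Z \<longleftrightarrow> Y \<subseteq> Z"
proof -
  have XY: "X \<in> B" "Y \<in> B" "X \<subset> Y" "\<not> (X \<subset> Z \<and> Z \<subset> Y)"
    using nb Z by (auto simp: immediate_neighbors_def)
  have "Z \<subseteq> X \<or> X \<subset> Z" "Y \<subseteq> Z \<or> Z \<subset> Y"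
    using chain_subset_cases[OF chain] XY(1,2) Z by metis+
  with XY(3,4) show "Z \<subseteq> X \<longleftrightarrow> Z \<subset> Y" "X \<subset> Z \<longleftrightarrow> Y \<subseteq> Z" by auto
qed

lemma K2_neighbors:
  assumes "K2 B" "X \<in> B" "Y \<in> B" "X \<subset> Y"
  obtains U V where "U \<in> IP B" "V \<in> IS B" "X \<subseteq> U" "U \<subset> V" "V \<subseteq> Y"
proof -
  obtain U V where "U \<in> B" "V \<in> B" "X \<subseteq> U" "U \<subset> V" "V \<subseteq> Y" "immediate_neighbors B U V"
    using assms unfolding K2_def by metis
  moreover from this have "U \<in> IP B" "V \<in> IS B" by (auto simp: IS_def IP_def)
  ultimately show thesis using that by metis
qed

lemma supremum_in_chain_if_Union:
  fixes B :: "'a set set"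
  assumes chain: "chain\<^sub>\<subseteq> B" and K2: "K2 B" and S: "S \<subseteq> B"
    and least: "\<exists>M\<in>B. \<forall>X\<in>B. M \<subseteq> X"
    and Union: "\<And>C. C \<noteq> {} \<Longrightarrow> C \<subseteq> IS B \<Longrightarrow> chain\<^sub>\<subseteq> C \<Longrightarrow> \<Union>C \<in> B"
  shows "\<exists>X\<in>B. (\<forall>W\<in>S. W \<subseteq> X) \<and> (\<forall>Z\<in>B. (\<forall>W\<in>S. W \<subseteq> Z) \<longrightarrow> X \<subseteq> Z)"
proof -
  \<comment> \<open>Closure under unions is available only inside \<open>IS B\<close>, so
    \<open>S\<close> is replaced by the members of \<open>IS B\<close> below it.\<close>
  define L where "L = {Y \<in> IS B. \<exists>W\<in>S. Y \<subseteq> W}"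
  have sub: "L \<subseteq> IS B" by (auto simp: L_def)
  have "chain\<^sub>\<subseteq> L" using chain unfolding chain_subset_def L_def IS_def by blast
  then have "\<exists>X\<in>B. (\<forall>Y\<in>L. Y \<subseteq> X) \<and> (\<forall>Z\<in>B. (\<forall>Y\<in>L. Y \<subseteq> Z) \<longrightarrow> X \<subseteq> Z)"
  proof (cases "L = {}")
    \<comment> \<open>The empty union need not belong to \<open>B\<close>; the smallest member takes
      its place.\<close>
    case True
    with least show ?thesis by auto
  next
    case False
    then have "\<Union>L \<in> B" using Union sub \<open>chain\<^sub>\<subseteq> L\<close> by blast
    then show ?thesis by blast
  qed
  then obtain X where X: "X \<in> B" "\<forall>Y\<in>L. Y \<subseteq> X" "\<And>Z. Z \<in> B \<Longrightarrow> \<forall>Y\<in>L. Y \<subseteq> Z \<Longrightarrow> X \<subseteq> Z"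
    by metis
  have ub: "W \<subseteq> X" if "W \<in> S" for W
  proof (rule chain_subset_cases[OF chain, of W X])
    \<comment> \<open>(K2) would put some \<open>V\<close> of \<open>IS B\<close> strictly above
      \<open>X\<close> and below \<open>W\<close>. Such a \<open>V\<close> lies in \<open>L\<close>,
      hence below \<open>X\<close>, a contradiction.\<close>
    assume "X \<subset> W"
    moreover have "W \<in> B" using S \<open>W \<in> S\<close> by blast
    ultimately obtain U V where "U \<in> IP B" "V \<in> IS B" "X \<subseteq> U" "U \<subset> V" "V \<subseteq> W"
      using K2_neighbors[OF K2 \<open>X \<in> B\<close>] by metis
    moreover from this have "V \<subseteq> X" using X \<open>W \<in> S\<close> by (auto simp: L_def)
    ultimately show ?thesis by blast
  qed (use X S that in auto)
  have "X \<subseteq> Z" if "Z \<in> B" "\<forall>W\<in>S. W \<subseteq> Z" for Z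
  proof (rule X(3))
    show "\<forall>Y\<in>L. Y \<subseteq> Z" using that by (auto simp: L_def)
  qed fact
  with ub X(1) show ?thesis by metis
qed

text \<open>The supremum is obtained as an infimum of upper bounds, so that (ii) feeds the same
  isomorphism arguments as (i).\<close>

lemma supremum_in_chain_if_Inter:
  fixes B :: "'a set set"
  assumes chain: "chain\<^sub>\<subseteq> B" and K2: "K2 B" and S: "S \<subseteq> B"
    and greatest: "\<exists>M\<in>B. \<forall>X\<in>B. X \<subseteq> M"
    and Inter: "\<And>C. C \<noteq> {} \<Longrightarrow> C \<subseteq> IP B \<Longrightarrow> chain\<^sub>\<subseteq> C \<Longrightarrow> \<Inter>C \<in> B"
  shows "\<exists>X\<in>B. (\<forall>W\<in>S. W \<subseteq> X) \<and> (\<forall>Z\<in>B. (\<forall>W\<in>S. W \<subseteq> Z) \<longrightarrow> X \<subseteq> Z)"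
proof -
  define R where "R = {Y \<in> IP B. \<forall>W\<in>S. W \<subseteq> Y}"
  have sub: "R \<subseteq> IP B" by (auto simp: R_def)
  have "chain\<^sub>\<subseteq> R" using chain unfolding chain_subset_def R_def IP_def by blast
  then have "\<exists>X\<in>B. (\<forall>Y\<in>R. X \<subseteq> Y) \<and> (\<forall>Z\<in>B. (\<forall>Y\<in>R. Z \<subseteq> Y) \<longrightarrow> Z \<subseteq> X)"
  proof (cases "R = {}")
    \<comment> \<open>The empty intersection is \<open>UNIV\<close>; the greatest member of
      \<open>B\<close> replaces it.\<close>
    case True
    with greatest show ?thesis by auto
  next
    case False
    then have "\<Inter>R \<in> B" using Inter sub \<open>chain\<^sub>\<subseteq> R\<close> by blast
    then show ?thesis by blast
  qed
  then obtain X where X: "X \<in> B" "\<forall>Y\<in>R. X \<subseteq> Y" "\<And>Z. Z \<in> B \<Longrightarrow> \<forall>Y\<in>R. Z \<subseteq> Y \<Longrightarrow> Z \<subseteq> X"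
    by metis
  have "W \<subseteq> X" if "W \<in> S" for W
  proof (rule X(3))
    show "W \<in> B" using that S by blast
    show "\<forall>Y\<in>R. W \<subseteq> Y" using that by (auto simp: R_def)
  qed
  moreover have "X \<subseteq> Z" if "Z \<in> B" "\<forall>W\<in>S. W \<subseteq> Z" for Z
  proof (rule chain_subset_cases[OF chain, of X Z])
    \<comment> \<open>The lower neighbor \<open>U\<close> contains the upper bound \<open>Z\<close>,
      so it is itself in \<open>R\<close>. This forces \<open>X \<subseteq> U\<close>, against
      \<open>U \<subset> V \<subseteq> X\<close>.\<close>
    assume "Z \<subset> X"
    then obtain U V where U: "U \<in> IP B" "V \<in> IS B" "Z \<subseteq> U" "U \<subset> V" "V \<subseteq> X"
      using K2_neighbors[OF K2 \<open>Z \<in> B\<close> \<open>X \<in> B\<close>] by metis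
    then have "U \<in> R" using that by (auto simp: R_def)
    then have "X \<subseteq> U" using X(2) by blast
    with U show ?thesis by blast
  qed (use X that in auto)
  ultimately show ?thesis using X(1) by metis
qed

text \<open>Injectivity comes from the order: if \<open>f x = f y\<close>, reflexivity at
  \<open>x\<close> carries over to \<open>leB (f x) (f y)\<close> and its converse, and antisymmetry
  of \<open>leA\<close> finishes.\<close>

lemma order_isomorphicI:
  assumes "f ` A = B"
    and "\<And>x y. x \<in> A \<Longrightarrow> y \<in> A \<Longrightarrow> leA x y \<longleftrightarrow> leB (f x) (f y)"
    and "\<And>x. x \<in> A \<Longrightarrow> leA x x"
    and "\<And>x y. x \<in> A \<Longrightarrow> y \<in> A \<Longrightarrow> leA x y \<Longrightarrow> leA y x \<Longrightarrow> x = y"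
  shows "order_isomorphic A leA B leB"
proof -
  have "inj_on f A" using assms(2-4) by (intro inj_onI) simp
  then show ?thesis
    unfolding order_isomorphic_def bij_betw_def using assms(1,2) by blast
qed

lemma order_isomorphic_cuts_IS:
  fixes B :: "'a set set"
  assumes chain: "chain\<^sub>\<subseteq> B" and K2: "K2 B"
    and sup: "\<And>S. S \<subseteq> B \<Longrightarrow> \<exists>X\<in>B. (\<forall>W\<in>S. W \<subseteq> X) \<and> (\<forall>Z\<in>B. (\<forall>W\<in>S. W \<subseteq> Z) \<longrightarrow> X \<subseteq> Z)"
  shows "order_isomorphic B (\<subseteq>) (cuts (IS B)) cut_le"
proof (rule order_isomorphicI)
  let ?f = "\<lambda>X. ({Y \<in> IS B. Y \<subseteq> X}, {Y \<in> IS B. \<not> Y \<subseteq> X})"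
  have IS: "IS B \<subseteq> B" by (auto simp: IS_def)
  have into: "?f X \<in> cuts (IS B)" if "X \<in> B" for X
  proof -
    have "U \<subset> V" if "U \<in> IS B" "U \<subseteq> X" "V \<in> IS B" "\<not> V \<subseteq> X" for U V
    proof -
      have "V \<in> B" "U \<in> B" using that IS by auto
      then show ?thesis using that by (cases rule: chain_subset_cases[OF chain]) auto
    qed
    then show ?thesis unfolding cuts_def by auto
  qed
  have onto: "c \<in> ?f ` B" if "c \<in> cuts (IS B)" for c
  proof -
    obtain L R where c: "c = (L, R)" by (cases c)
    from that have LR: "L \<inter> R = {}" "L \<union> R = IS B" "\<And>U V. U \<in> L \<Longrightarrow> V \<in> R \<Longrightarrow> U \<subset> V"
      unfolding c cuts_def by auto
    obtain X where X: "X \<in> B" "\<forall>W\<in>L. W \<subseteq> X" "\<And>Z. Z \<in> B \<Longrightarrow> \<forall>W\<in>L. W \<subseteq> Z \<Longrightarrow> X \<subseteq> Z"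
      using sup[of L] LR(2) IS by (metis Un_upper1 order_trans)
    have "\<not> Y \<subseteq> X" if Y: "Y \<in> R" for Y
    proof -
      have "Y \<in> IS B" using Y LR by blast
      \<comment> \<open>The supremum of \<open>L\<close> must not reach \<open>R\<close>. The
        predecessor \<open>P\<close> of \<open>Y\<close> prevents this: being strictly below
        \<open>Y\<close>, all of \<open>L\<close> lies below \<open>P\<close>, and so does
        \<open>X\<close>.\<close>
      then obtain P where P: "immediate_neighbors B P Y" by (auto simp: IS_def)
      then have PB: "P \<in> B" "P \<subset> Y" by (auto simp: immediate_neighbors_def)
      have "W \<subseteq> P" if "W \<in> L" for W
      proof -
        have "W \<in> B" using that LR(2) IS by auto
        then show ?thesis using immediate_neighbors_chain(1)[OF chain P] LR(3) that Y by simp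
      qed
      then have "X \<subseteq> P" using X(3) PB by simp
      with PB show ?thesis by blast
    qed
    moreover have "Y \<subseteq> X" if "Y \<in> L" for Y
      using that X(2) by simp
    ultimately have "c = ?f X" unfolding c using LR by auto
    with X(1) show ?thesis by blast
  qed
  show "?f ` B = cuts (IS B)" using into onto by blast
  show "X \<subseteq> Y \<longleftrightarrow> cut_le (?f X) (?f Y)" if "X \<in> B" "Y \<in> B" for X Y
  proof
    show "cut_le (?f X) (?f Y)" if "X \<subseteq> Y" using that by (auto simp: cut_le_def)
    assume le: "cut_le (?f X) (?f Y)"
    show "X \<subseteq> Y"
    proof (rule chain_subset_cases[OF chain that])
      \<comment> \<open>The upper neighbor \<open>V\<close> would belong to the lower part for
        \<open>X\<close> but not to that for \<open>Y\<close>.\<close>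
      assume "Y \<subset> X"
      then obtain U V where UV: "U \<in> IP B" "V \<in> IS B" "Y \<subseteq> U" "U \<subset> V" "V \<subseteq> X"
        using K2_neighbors[OF K2 \<open>Y \<in> B\<close> \<open>X \<in> B\<close>] by metis
      then have "V \<subseteq> Y" using le by (auto simp: cut_le_def)
      with UV show ?thesis by blast
    qed
  qed
qed auto

text \<open>The cut uses strict inclusion because for neighbors \<open>U \<subset> V\<close> it is
  \<open>U\<close> that must tell them apart: with weak inclusion both would get the same cut
  whenever \<open>V\<close> is not in \<open>IP B\<close>.\<close>

lemma order_isomorphic_cuts_IP:
  fixes B :: "'a set set"
  assumes chain: "chain\<^sub>\<subseteq> B" and K2: "K2 B"
    and sup: "\<And>S. S \<subseteq> B \<Longrightarrow> \<exists>X\<in>B. (\<forall>W\<in>S. W \<subseteq> X) \<and> (\<forall>Z\<in>B. (\<forall>W\<in>S. W \<subseteq> Z) \<longrightarrow> X \<subseteq> Z)"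
  shows "order_isomorphic B (\<subseteq>) (cuts (IP B)) cut_le"
proof (rule order_isomorphicI)
  let ?f = "\<lambda>X. ({Y \<in> IP B. Y \<subset> X}, {Y \<in> IP B. \<not> Y \<subset> X})"
  have IP: "IP B \<subseteq> B" by (auto simp: IP_def)
  have into: "?f X \<in> cuts (IP B)" if "X \<in> B" for X
  proof -
    have "U \<subset> V" if "U \<in> IP B" "U \<subset> X" "V \<in> IP B" "\<not> V \<subset> X" for U V
    proof -
      have "V \<in> B" "U \<in> B" using that IP by auto
      then show ?thesis using that by (cases rule: chain_subset_cases[OF chain]) auto
    qed
    then show ?thesis unfolding cuts_def by auto
  qed
  have onto: "c \<in> ?f ` B" if "c \<in> cuts (IP B)" for c
  proof -
    obtain L R where c: "c = (L, R)" by (cases c)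
    from that have LR: "L \<inter> R = {}" "L \<union> R = IP B" "\<And>U V. U \<in> L \<Longrightarrow> V \<in> R \<Longrightarrow> U \<subset> V"
      unfolding c cuts_def by auto
    \<comment> \<open>The supremum of \<open>L\<close> itself could lie in \<open>L\<close>, so the successors are used instead.\<close>
    define S where "S = {Z. \<exists>Y\<in>L. immediate_neighbors B Y Z}"
    have "S \<subseteq> B" by (auto simp: S_def immediate_neighbors_def)
    then obtain X where X: "X \<in> B" "\<forall>W\<in>S. W \<subseteq> X" "\<And>Z. Z \<in> B \<Longrightarrow> \<forall>W\<in>S. W \<subseteq> Z \<Longrightarrow> X \<subseteq> Z"
      using sup[of S] by metis
    have "Y \<subset> X" if Y: "Y \<in> L" for Y
    proof -
      have "Y \<in> IP B" using Y LR by blast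
      then obtain Z where Z: "immediate_neighbors B Y Z" by (auto simp: IP_def)
      then have "Z \<in> S" using Y by (auto simp: S_def)
      then have "Z \<subseteq> X" using X(2) by simp
      with Z show ?thesis by (auto simp: immediate_neighbors_def)
    qed
    moreover have "\<not> Y \<subset> X" if Y: "Y \<in> R" for Y
    proof -
      have "Y \<in> B" using Y LR IP by blast
      \<comment> \<open>Each \<open>W\<close> in \<open>S\<close> succeeds some \<open>U\<close> in
        \<open>L\<close> immediately. As \<open>Y\<close> is strictly above \<open>U\<close>, it
        already contains \<open>W\<close>; thus \<open>Y\<close> bounds \<open>S\<close>.\<close>
      have "W \<subseteq> Y" if "W \<in> S" for W
      proof -
        obtain U where U: "U \<in> L" "immediate_neighbors B U W" using \<open>W \<in> S\<close> by (auto simp: S_def)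
        then show ?thesis
          using immediate_neighbors_chain(2)[OF chain U(2) \<open>Y \<in> B\<close>] LR(3) Y by simp
      qed
      then have "X \<subseteq> Y" using X(3) \<open>Y \<in> B\<close> by simp
      then show ?thesis by blast
    qed
    ultimately have "c = ?f X" unfolding c using LR(1,2) by (simp add: set_eq_iff) metis
    with X(1) show ?thesis by blast
  qed
  show "?f ` B = cuts (IP B)" using into onto by blast
  show "X \<subseteq> Y \<longleftrightarrow> cut_le (?f X) (?f Y)" if "X \<in> B" "Y \<in> B" for X Y
  proof
    show "cut_le (?f X) (?f Y)" if "X \<subseteq> Y" using that by (auto simp: cut_le_def)
    assume le: "cut_le (?f X) (?f Y)"
    show "X \<subseteq> Y"
    proof (rule chain_subset_cases[OF chain that])
      assume "Y \<subset> X"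
      then obtain U V where UV: "U \<in> IP B" "V \<in> IS B" "Y \<subseteq> U" "U \<subset> V" "V \<subseteq> X"
        using K2_neighbors[OF K2 \<open>Y \<in> B\<close> \<open>X \<in> B\<close>] by metis
      \<comment> \<open>Here the lower neighbor is the witness: \<open>U\<close> is strictly below
        \<open>X\<close> but contains \<open>Y\<close>.\<close>
      have "U \<in> {Z \<in> IP B. Z \<subset> X}" using UV by auto
      then have "U \<subset> Y" using le by (simp add: cut_le_def) blast
      with UV show ?thesis by blast
    qed
  qed
qed auto

theorem theorem2p7:
  fixes B :: "'a set set"
  assumes nonempty: "B \<noteq> {}"
    and K2: "K2 B"
    and i_or_ii:
      "((\<exists>M\<in>B. \<forall>X\<in>B. M \<subseteq> X) \<and>
          (\<forall>C. C \<noteq> {} \<and> C \<subseteq> IS B \<and> chain\<^sub>\<subseteq> C \<longrightarrow> (\<Union>X\<in>C. X) \<in> B)) \<or>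
       ((\<exists>M\<in>B. \<forall>X\<in>B. X \<subseteq> M) \<and>
          (\<forall>C. C \<noteq> {} \<and> C \<subseteq> IP B \<and> chain\<^sub>\<subseteq> C \<longrightarrow> (\<Inter>X\<in>C. X) \<in> B))"
    and chain: "chain\<^sub>\<subseteq> B"
  shows "order_isomorphic B (\<subseteq>) (cuts (IS B)) cut_le \<and>
         order_isomorphic B (\<subseteq>) (cuts (IP B)) cut_le"
proof -
  \<comment> \<open>Both alternatives enter the isomorphisms only through this common consequence,
    the existence of suprema in \<open>B\<close>.\<close>
  have sup: "\<exists>X\<in>B. (\<forall>W\<in>S. W \<subseteq> X) \<and> (\<forall>Z\<in>B. (\<forall>W\<in>S. W \<subseteq> Z) \<longrightarrow> X \<subseteq> Z)" if "S \<subseteq> B" for S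
    using i_or_ii
  proof
    assume "(\<exists>M\<in>B. \<forall>X\<in>B. M \<subseteq> X) \<and>
      (\<forall>C. C \<noteq> {} \<and> C \<subseteq> IS B \<and> chain\<^sub>\<subseteq> C \<longrightarrow> (\<Union>X\<in>C. X) \<in> B)"
    then show ?thesis by (intro supremum_in_chain_if_Union chain K2 that) simp_all
  next
    assume "(\<exists>M\<in>B. \<forall>X\<in>B. X \<subseteq> M) \<and>
      (\<forall>C. C \<noteq> {} \<and> C \<subseteq> IP B \<and> chain\<^sub>\<subseteq> C \<longrightarrow> (\<Inter>X\<in>C. X) \<in> B)"
    then show ?thesis by (intro supremum_in_chain_if_Inter chain K2 that) simp_all
  qed
  show ?thesis
    using order_isomorphic_cuts_IS[OF chain K2 sup] order_isomorphic_cuts_IP[OF chain K2 sup]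
    by blast
qed

end
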